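(* Assume $\tau<0$ and $n=2$. There is no positive solution $u\in C^2(\mathbf{R}^2)$ of $$\Delta u=u^{\tau}\quad\text{in }\mathbf{R}^2$$ with finite Morse index.
   Context: Let $u\in C^2(\mathbf{R}^n)$ be a positive solution of $\Delta u=u^{\tau}$ in $\mathbf{R}^n$, $\tau<0$. For $\phi\in C^2_0(\mathbf{R}^n)$ ($C^2$ functions with compact support) define $$E(\phi)=\int_{\mathbf{R}^n}\left(|\nabla\phi|^2+\tau u^{\tau-1}\phi^2\right).$$ The solution $u$ is said to have finite Morse index $k$ (with $k$ a nonnegative integer) if there exist $L^2$-orthogonal nontrivial functions $\{\phi_j\}_{j=1}^k\subset C^2_0(\mathbf{R}^n)$ such that, with $\mathbf{W}:=\mathrm{span}\{\phi_j\}\setminus\{0\}$, one has $E(\phi)<0$ for all $\phi\in\mathbf{W}$, and $E(\phi)\ge 0$ for all $\phi\in C^2_0(\mathbf{R}^n)$ that are $L^2$-orthogonal to $\mathbf{W}$. *)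

theory Defs
  imports "HOL-Analysis.Analysis"
begin

definition partial :: "'a::euclidean_space \<Rightarrow> ('a \<Rightarrow> real) \<Rightarrow> 'a \<Rightarrow> real" where
  "partial i f x = frechet_derivative f (at x) i"

definition C1 :: "('a::euclidean_space \<Rightarrow> real) \<Rightarrow> bool" where
  "C1 f \<longleftrightarrow> (\<forall>x. f differentiable (at x)) \<and> (\<forall>i\<in>Basis. continuous_on UNIV (partial i f))"

definition C2 :: "('a::euclidean_space \<Rightarrow> real) \<Rightarrow> bool" where
  "C2 f \<longleftrightarrow> C1 f \<and> (\<forall>i\<in>Basis. C1 (partial i f))"

definition C2_compact :: "('a::euclidean_space \<Rightarrow> real) set" where
  "C2_compact = {f. C2 f \<and> compact (closure {x. f x \<noteq> 0})}"

definition grad :: "('a::euclidean_space \<Rightarrow> real) \<Rightarrow> 'a \<Rightarrow> 'a" where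
  "grad f x = (\<Sum>i\<in>Basis. partial i f x *\<^sub>R i)"

definition laplacian :: "('a::euclidean_space \<Rightarrow> real) \<Rightarrow> 'a \<Rightarrow> real" where
  "laplacian f x = (\<Sum>i\<in>Basis. partial i (partial i f) x)"

definition positive_solution :: "real \<Rightarrow> ('a::euclidean_space \<Rightarrow> real) \<Rightarrow> bool" where
  "positive_solution \<tau> u \<longleftrightarrow>
     C2 u \<and> (\<forall>x. u x > 0) \<and> (\<forall>x. laplacian u x = u x powr \<tau>)"

definition energy :: "real \<Rightarrow> ('a::euclidean_space \<Rightarrow> real) \<Rightarrow> ('a \<Rightarrow> real) \<Rightarrow> real" where
  "energy \<tau> u \<phi> =
     (LINT x|lborel. (norm (grad \<phi> x))\<^sup>2 + \<tau> * u x powr (\<tau> - 1) * (\<phi> x)\<^sup>2)"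

definition L2_orthogonal :: "('a::euclidean_space \<Rightarrow> real) \<Rightarrow> ('a \<Rightarrow> real) \<Rightarrow> bool" where
  "L2_orthogonal f g \<longleftrightarrow> (LINT x|lborel. f x * g x) = 0"

(* The library's span does not apply: functions into the reals are not an instance of
   real_vector. For k = 0 the only linear combination is the zero function. *)
definition lin_span :: "nat \<Rightarrow> (nat \<Rightarrow> 'a \<Rightarrow> real) \<Rightarrow> ('a \<Rightarrow> real) set" where
  "lin_span k \<phi> = {\<psi>. \<exists>c :: nat \<Rightarrow> real. \<psi> = (\<lambda>x. \<Sum>j=1..k. c j * \<phi> j x)}"

definition has_morse_index :: "real \<Rightarrow> ('a::euclidean_space \<Rightarrow> real) \<Rightarrow> nat \<Rightarrow> bool" where
  "has_morse_index \<tau> u k \<longleftrightarrow>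
     (\<exists>\<phi> :: nat \<Rightarrow> 'a \<Rightarrow> real.
        (\<forall>j\<in>{1..k}. \<phi> j \<in> C2_compact \<and> \<phi> j \<noteq> (\<lambda>x. 0)) \<and>
        (\<forall>i\<in>{1..k}. \<forall>j\<in>{1..k}. i \<noteq> j \<longrightarrow> L2_orthogonal (\<phi> i) (\<phi> j)) \<and>
        (let W = lin_span k \<phi> - {\<lambda>x. 0} in
           (\<forall>\<psi>\<in>W. energy \<tau> u \<psi> < 0) \<and>
           (\<forall>\<psi>\<in>C2_compact. (\<forall>w\<in>W. L2_orthogonal \<psi> w) \<longrightarrow> energy \<tau> u \<psi> \<ge> 0)))"

definition finite_morse_index :: "real \<Rightarrow> ('a::euclidean_space \<Rightarrow> real) \<Rightarrow> bool" where
  "finite_morse_index \<tau> u \<longleftrightarrow> (\<exists>k. has_morse_index \<tau> u k)"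

end

theory Submission
  imports Defs
begin

text \<open>
Suppose that \<open>u\<close> is a positive solution of finite Morse index in the plane, and put \<open>v = ln u\<close>,
\<open>w = u powr (\<tau> - 1)\<close> and \<open>s = 1 - \<tau> > 0\<close>, so that \<open>w = exp (- s * v)\<close>.

Finite Morse index means stability outside a ball
(\<open>finite_morse_index_imp_stable_outside_ball\<close>): there \<open>- \<tau> * \<integral> w \<phi>\<^sup>2 \<le> \<integral> |grad \<phi>|\<^sup>2\<close>. In the
plane there are cut-off functions of arbitrarily large radius whose Dirichlet integrals are
uniformly bounded, so \<open>w\<close> is integrable over the whole plane (\<open>weighted_integral_bounded\<close>).

The function \<open>v\<close> satisfies \<open>laplacian v = w - |grad v|\<^sup>2\<close> (\<open>laplacian_ln\<close>). Testing this with the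
square of a cut-off shows that \<open>|grad v|\<^sup>2\<close> is integrable as well (\<open>riccati_dirichlet_le\<close>).

The two facts are incompatible. A function with finite Dirichlet integral in the plane has means
over squares of side \<open>R\<close> that grow slower than any multiple of \<open>ln R\<close>; but integrability of
\<open>exp (- s * v)\<close> forces the means of \<open>v\<close> to grow at least like \<open>(2 / s) * ln R\<close>
(\<open>no_finite_dirichlet_integral_with_integrable_exp\<close>).
\<close>

section \<open>Functions of class \<open>C1\<close> and \<open>C2\<close>\<close>

lemma GDERIV_imp_partial:
  assumes "GDERIV f x :> D"
  shows "partial i f x = D \<bullet> i"
proof -
  have "(\<lambda>h. h \<bullet> D) = frechet_derivative f (at x)"
    using assms frechet_derivative_at unfolding gderiv_def by blast
  then show ?thesis
    unfolding partial_def by (metis inner_commute)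
qed

lemma GDERIV_imp_grad:
  assumes "GDERIV f x :> D"
  shows "grad f x = D"
  unfolding grad_def using GDERIV_imp_partial[OF assms] by (simp add: euclidean_representation)

lemma C1_imp_GDERIV:
  assumes "C1 f"
  shows "GDERIV f x :> grad f x"
proof -
  let ?L = "frechet_derivative f (at x)"
  have d: "(f has_derivative ?L) (at x)"
    using assms frechet_derivative_works unfolding C1_def by blast
  then interpret L: bounded_linear ?L by (rule has_derivative_bounded_linear)
  have "?L h = h \<bullet> grad f x" for h
  proof -
    have "?L h = ?L (\<Sum>i\<in>Basis. (h \<bullet> i) *\<^sub>R i)" by (simp add: euclidean_representation)
    also have "\<dots> = (\<Sum>i\<in>Basis. (h \<bullet> i) * partial i f x)"
      by (simp add: L.sum L.scaleR partial_def)
    also have "\<dots> = h \<bullet> grad f x"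
      by (simp add: grad_def inner_sum_right mult.commute)
    finally show ?thesis .
  qed
  then show ?thesis using d unfolding gderiv_def by presburger
qed

lemma partial_eq_grad_inner:
  assumes "C1 f"
  shows "partial i f x = grad f x \<bullet> i"
  using GDERIV_imp_partial[OF C1_imp_GDERIV[OF assms]] .

lemma C1_imp_continuous_grad: "C1 f \<Longrightarrow> continuous_on UNIV (grad f)"
  unfolding grad_def[abs_def] C1_def by (intro continuous_intros) auto

lemma C1_imp_continuous: "C1 f \<Longrightarrow> continuous_on UNIV f"
  unfolding C1_def by (meson continuous_at_imp_continuous_on differentiable_imp_continuous_within)

lemma C1_I:
  assumes G: "\<And>x. GDERIV f x :> G x" "continuous_on UNIV G"
  shows "C1 f"
proof -
  have "partial i f = (\<lambda>x. G x \<bullet> i)" for i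
    using GDERIV_imp_partial[OF G(1)] by blast
  moreover have "f differentiable (at x)" for x
    using G(1)[of x] unfolding gderiv_def differentiable_def by blast
  moreover have "continuous_on UNIV (\<lambda>x. G x \<bullet> i)" for i
    by (intro continuous_intros G(2))
  ultimately show ?thesis unfolding C1_def by simp
qed

lemma C1_const: "C1 (\<lambda>x. c)"
  by (rule C1_I[where G="\<lambda>x. 0"]) (auto intro: GDERIV_const)

lemma GDERIV_inner_self: "GDERIV (\<lambda>x. x \<bullet> x) x :> 2 *\<^sub>R x"
  unfolding gderiv_def by (auto intro!: derivative_eq_intros simp: inner_commute)

lemma C1_inner_const: "C1 (\<lambda>x. c * (x \<bullet> a))"
  by (rule C1_I[where G="\<lambda>x. c *\<^sub>R a"])
     (auto simp: gderiv_def intro!: derivative_eq_intros)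

lemma C1_diff:
  assumes "C1 f" "C1 g" shows "C1 (\<lambda>x. f x - g x)"
  by (rule C1_I[OF GDERIV_diff[OF C1_imp_GDERIV[OF assms(1)] C1_imp_GDERIV[OF assms(2)]]])
     (intro continuous_intros assms C1_imp_continuous_grad)

lemma C1_add:
  assumes "C1 f" "C1 g" shows "C1 (\<lambda>x. f x + g x)"
  by (rule C1_I[OF GDERIV_add[OF C1_imp_GDERIV[OF assms(1)] C1_imp_GDERIV[OF assms(2)]]])
     (intro continuous_intros assms C1_imp_continuous_grad)

lemma C1_mult:
  assumes "C1 f" "C1 g" shows "C1 (\<lambda>x. f x * g x)"
  by (rule C1_I[OF GDERIV_mult[OF C1_imp_GDERIV[OF assms(1)] C1_imp_GDERIV[OF assms(2)]]])
     (intro continuous_intros assms C1_imp_continuous_grad C1_imp_continuous)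

lemma grad_mult:
  assumes "C1 f" "C1 g"
  shows "grad (\<lambda>x. f x * g x) x = f x *\<^sub>R grad g x + g x *\<^sub>R grad f x"
  by (rule GDERIV_imp_grad[OF GDERIV_mult[OF C1_imp_GDERIV[OF assms(1)] C1_imp_GDERIV[OF assms(2)]]])

lemma partial_mult:
  assumes "C1 f" "C1 g"
  shows "partial i (\<lambda>x. f x * g x) x = f x * partial i g x + g x * partial i f x"
  using assms by (simp add: partial_eq_grad_inner C1_mult grad_mult inner_add_left)

lemma partial_diff:
  assumes "C1 f" "C1 g"
  shows "partial i (\<lambda>x. f x - g x) x = partial i f x - partial i g x"
  using GDERIV_imp_partial[OF GDERIV_diff[OF C1_imp_GDERIV[OF assms(1)] C1_imp_GDERIV[OF assms(2)]]]
  assms by (simp add: partial_eq_grad_inner inner_diff_left)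

lemma GDERIV_compose:
  assumes "C1 f" "(p has_real_derivative p') (at (f x))"
  shows "GDERIV (\<lambda>x. p (f x)) x :> p' *\<^sub>R grad f x"
  using GDERIV_DERIV_compose[OF C1_imp_GDERIV[OF assms(1)] assms(2)] .

lemma C1_compose:
  assumes "C1 f" "\<And>x. (p has_real_derivative p' (f x)) (at (f x))" "continuous_on (range f) p'"
  shows "C1 (\<lambda>x. p (f x))"
proof (rule C1_I[OF GDERIV_compose[OF assms(1,2)]])
  have "continuous_on UNIV (\<lambda>x. p' (f x))"
    using continuous_on_compose[OF C1_imp_continuous[OF assms(1)] assms(3)] by (simp add: o_def)
  then show "continuous_on UNIV (\<lambda>x. p' (f x) *\<^sub>R grad f x)"
    by (intro continuous_intros C1_imp_continuous_grad assms)
qed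

lemma grad_compose:
  assumes "C1 f" "(p has_real_derivative p') (at (f x))"
  shows "grad (\<lambda>x. p (f x)) x = p' *\<^sub>R grad f x"
  by (rule GDERIV_imp_grad[OF GDERIV_compose[OF assms]])

lemma partial_compose:
  assumes "C1 f" "(p has_real_derivative p') (at (f x))"
  shows "partial i (\<lambda>x. p (f x)) x = p' * partial i f x"
  using GDERIV_imp_partial[OF GDERIV_compose[OF assms]] assms(1)
  by (simp add: partial_eq_grad_inner)

lemma C2_imp_C1: "C2 f \<Longrightarrow> C1 f"
  and C2_imp_C1_partial: "C2 f \<Longrightarrow> i \<in> Basis \<Longrightarrow> C1 (partial i f)"
  unfolding C2_def by auto

lemma partial_const: "partial i (\<lambda>x. c) x = 0"
  using GDERIV_imp_partial[OF GDERIV_const] by simp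

lemma C2_const: "C2 (\<lambda>x. c)"
  unfolding C2_def by (simp add: partial_const[abs_def] C1_const)

lemma C1_inner_self: "C1 (\<lambda>x. x \<bullet> x)"
  by (rule C1_I[OF GDERIV_inner_self]) (intro continuous_intros)

lemma C2_inner_self: "C2 (\<lambda>x. x \<bullet> x)"
proof -
  have "partial i (\<lambda>x. x \<bullet> x) = (\<lambda>x. 2 * (x \<bullet> i))" for i :: 'a
    using GDERIV_imp_partial[OF GDERIV_inner_self] by auto
  then show ?thesis unfolding C2_def using C1_inner_self C1_inner_const by auto
qed

lemma C2_diff:
  assumes "C2 f" "C2 g" shows "C2 (\<lambda>x. f x - g x)"
proof -
  have "partial i (\<lambda>x. f x - g x) = (\<lambda>x. partial i f x - partial i g x)" for i
    using partial_diff assms C2_imp_C1 by blast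
  then show ?thesis using assms unfolding C2_def by (auto intro!: C1_diff)
qed

lemma C2_mult:
  assumes "C2 f" "C2 g" shows "C2 (\<lambda>x. f x * g x)"
proof -
  have "partial i (\<lambda>x. f x * g x) = (\<lambda>x. f x * partial i g x + g x * partial i f x)" for i
    using partial_mult assms C2_imp_C1 by blast
  then show ?thesis using assms unfolding C2_def by (auto intro!: C1_mult C1_add)
qed

lemma C2_compose:
  assumes "C2 f"
    and p: "\<And>x. (p has_real_derivative p' (f x)) (at (f x))"
    and p': "\<And>x. (p' has_real_derivative p'' (f x)) (at (f x))"
    and "continuous_on (range f) p''"
  shows "C2 (\<lambda>x. p (f x))"
proof -
  note f = C2_imp_C1[OF assms(1)]
  have "continuous_on (range f) p'"
    by (metis DERIV_isCont continuous_at_imp_continuous_on p' rangeE)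
  then have "C1 (\<lambda>x. p (f x))"
    by (rule C1_compose[OF f p])
  moreover have "partial i (\<lambda>x. p (f x)) = (\<lambda>x. p' (f x) * partial i f x)" for i
    using partial_compose[OF f p] by blast
  moreover have "C1 (\<lambda>x. p' (f x))"
    by (rule C1_compose[OF f p' assms(4)])
  ultimately show ?thesis
    unfolding C2_def using C1_mult C2_imp_C1_partial[OF assms(1)] by auto
qed

text \<open>A polynomial profile of the positive part gives compact support with explicit derivatives;
  the exponent three below is the least one for which it is twice continuously differentiable.\<close>

lemma DERIV_pos_part_power:
  fixes y :: real
  shows "((\<lambda>y. max 0 y ^ Suc (Suc n)) has_real_derivative real (Suc (Suc n)) * max 0 y ^ Suc n) (at y)"
proof (cases "y = 0")
  case True
  have "((\<lambda>h. (max 0 h ^ Suc (Suc n)) / h) \<longlongrightarrow> 0) (at (0::real))"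
  proof (rule Lim_null_comparison)
    show "\<forall>\<^sub>F h in at (0::real). norm (max 0 h ^ Suc (Suc n) / h) \<le> max 0 h ^ Suc n"
      by (auto simp: max_def intro!: always_eventually)
    have "isCont (\<lambda>h::real. max 0 h ^ Suc n) 0" by (intro continuous_intros)
    then show "((\<lambda>h::real. max 0 h ^ Suc n) \<longlongrightarrow> 0) (at 0)"
      by (simp add: isCont_def)
  qed
  then show ?thesis using True by (simp add: DERIV_def)
next
  case False
  then consider "y > 0" | "y < 0" by linarith
  then show ?thesis
  proof cases
    case 1
    have d: "((\<lambda>y. y ^ Suc (Suc n)) has_real_derivative real (Suc (Suc n)) * max 0 y ^ Suc n) (at y)"
      using 1 DERIV_pow[of "Suc (Suc n)" y] by (simp add: max_def del: power_Suc)
    have ev: "\<forall>\<^sub>F z in nhds y. max 0 z ^ Suc (Suc n) = z ^ Suc (Suc n)"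
      by (rule eventually_mono[OF eventually_nhds_in_open[of "{0<..}" y]]) (use 1 in auto)
    show ?thesis by (rule iffD2[OF DERIV_cong_ev[OF refl ev refl] d])
  next
    case 2
    have d: "((\<lambda>y. 0) has_real_derivative real (Suc (Suc n)) * max 0 y ^ Suc n) (at y)"
      using 2 by (auto simp: max_def)
    have ev: "\<forall>\<^sub>F z in nhds y. max 0 z ^ Suc (Suc n) = 0"
      by (rule eventually_mono[OF eventually_nhds_in_open[of "{..<0}" y]]) (use 2 in auto)
    show ?thesis by (rule iffD2[OF DERIV_cong_ev[OF refl ev refl] d])
  qed
qed

lemma C2_pos_part_cube:
  assumes "C2 f" shows "C2 (\<lambda>x. max 0 (f x) ^ 3)"
proof (rule C2_compose[OF assms, where p = "\<lambda>y. max 0 y ^ 3"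
      and p' = "\<lambda>y. 3 * max 0 y ^ 2" and p'' = "\<lambda>y. 6 * max 0 y"])
  fix x
  show "((\<lambda>y. max 0 y ^ 3) has_real_derivative 3 * (max 0 (f x))\<^sup>2) (at (f x))"
    using DERIV_pos_part_power[of 1 "f x"] by (simp add: eval_nat_numeral)
  show "((\<lambda>y. 3 * (max 0 y)\<^sup>2) has_real_derivative 6 * max 0 (f x)) (at (f x))"
    using DERIV_cmult[OF DERIV_pos_part_power[of 0 "f x"], of 3] by (simp add: eval_nat_numeral)
qed (intro continuous_intros)

section \<open>Integrals of divergences\<close>

lemma integrable_compact_support:
  fixes f :: "'a::euclidean_space \<Rightarrow> real"
  assumes "continuous_on UNIV f" "\<And>x. norm x > r \<Longrightarrow> f x = 0"
  shows "integrable lborel f"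
proof -
  have "integrable lborel (\<lambda>x. indicator (cball 0 r) x *\<^sub>R f x)"
    by (rule borel_integrable_compact) (auto intro: continuous_on_subset[OF assms(1)])
  moreover have "(\<lambda>x. indicator (cball 0 r) x *\<^sub>R f x) = f"
    using assms(2) by (auto simp: indicator_def fun_eq_iff not_le)
  ultimately show ?thesis by simp
qed

lemma integral_eq_integral_UNIV:
  fixes f :: "'a::euclidean_space \<Rightarrow> real"
  assumes "\<And>x. x \<notin> S \<Longrightarrow> f x = 0"
  shows "integral UNIV f = integral S f"
proof -
  have "(\<lambda>x. if x \<in> S then f x else 0) = f" using assms by auto
  then show ?thesis by (metis integral_restrict_UNIV)
qed

lemma grad_eq_0_outside_support:
  assumes "\<And>x. norm x > r \<Longrightarrow> f x = 0" "norm x > r"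
  shows "grad f x = 0"
proof -
  have "open {x::'a. norm x > r}"
    by (intro open_Collect_less continuous_intros)
  then have "(f has_derivative (\<lambda>h. 0)) (at x)"
    by (rule has_derivative_transform_within_open[OF has_derivative_const]) (use assms in auto)
  then have "GDERIV f x :> 0" by (simp add: gderiv_def)
  then show ?thesis by (rule GDERIV_imp_grad)
qed

lemma integral_lborel_translate:
  fixes f :: "'a::euclidean_space \<Rightarrow> real"
  assumes "f \<in> borel_measurable borel"
  shows "(LINT x|lborel. f (c + x)) = (LINT x|lborel. f x)"
proof -
  have "(LINT x|lborel. f x) = (LINT x|distr lborel borel ((+) c). f x)"
    by (simp add: lborel_distr_plus)
  also have "\<dots> = (LINT x|lborel. f (c + x))"
    by (rule integral_distr) (use assms in auto)
  finally show ?thesis by simp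
qed

text \<open>Translating a compactly supported function does not change its integral, so the derivative
  of the integral with respect to the translation, which is the integral of the partial derivative,
  vanishes.\<close>

lemma integral_partial_eq_0:
  fixes f :: "'a::euclidean_space \<Rightarrow> real"
  assumes f: "C1 f" and supp: "\<And>x. norm x > r \<Longrightarrow> f x = 0" and i: "i \<in> Basis"
  shows "(LINT x|lborel. partial i f x) = 0"
proof -
  obtain a :: 'a where a: "cball 0 (r + 1) \<subseteq> cbox (- a) a"
    using bounded_subset_cbox_symmetric[OF bounded_cball] by blast
  let ?g = "\<lambda>t. integral (cbox (- a) a) (\<lambda>x. f (x + t *\<^sub>R i))"
  have cf: "continuous_on UNIV f" and cg: "continuous_on UNIV (grad f)"
    using C1_imp_continuous[OF f] C1_imp_continuous_grad[OF f] by auto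
  have outside: "f (x + t *\<^sub>R i) = 0" if "x \<notin> cbox (- a) a" "t \<in> {-1..1}" for x t
  proof -
    have "norm x > r + 1" using that(1) a by (auto simp: subset_eq not_le)
    moreover have "norm x \<le> norm (x + t *\<^sub>R i) + norm (t *\<^sub>R i)"
      using norm_triangle_ineq4[of "x + t *\<^sub>R i" "t *\<^sub>R i"] by simp
    moreover have "norm (t *\<^sub>R i) \<le> 1" using that i by auto
    ultimately show ?thesis by (intro supp) linarith
  qed
  have const: "?g t = (LINT x|lborel. f x)" if "t \<in> {-1..1}" for t
  proof -
    have "?g t = integral UNIV (\<lambda>x. f (x + t *\<^sub>R i))"
      by (rule integral_eq_integral_UNIV[symmetric]) (use outside[OF _ that] in auto)
    also have "\<dots> = (LINT x|lborel. f (x + t *\<^sub>R i))"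
    proof (rule integral_lborel, rule integrable_compact_support)
      show "continuous_on UNIV (\<lambda>x. f (x + t *\<^sub>R i))"
        by (intro continuous_on_compose2[OF cf] continuous_intros) auto
      fix x :: 'a
      assume "norm x > max (r + 1) (norm a)"
      moreover have "norm x \<le> norm (x + t *\<^sub>R i) + norm (t *\<^sub>R i)"
        using norm_triangle_ineq4[of "x + t *\<^sub>R i" "t *\<^sub>R i"] by simp
      moreover have "norm (t *\<^sub>R i) \<le> 1" using that i by auto
      ultimately show "f (x + t *\<^sub>R i) = 0" by (intro supp) linarith
    qed
    also have "\<dots> = (LINT x|lborel. f x)"
      using integral_lborel_translate[of f "t *\<^sub>R i"] borel_measurable_continuous_onI[OF cf]
      by (simp add: add.commute)
    finally show ?thesis .
  qed
  have "(?g has_field_derivative integral (cbox (- a) a) (\<lambda>x. grad f (x + 0 *\<^sub>R i) \<bullet> i))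
      (at 0 within {-1..1})"
  proof (rule leibniz_rule_field_derivative)
    fix t x
    have "((\<lambda>t. f (x + t *\<^sub>R i)) has_derivative (\<lambda>s. (s *\<^sub>R i) \<bullet> grad f (x + t *\<^sub>R i))) (at t within {-1..1})"
      by (rule has_derivative_compose[where f = "\<lambda>t. x + t *\<^sub>R i"])
        (auto intro!: derivative_eq_intros C1_imp_GDERIV[OF f, unfolded gderiv_def])
    then show "((\<lambda>t. f (x + t *\<^sub>R i)) has_field_derivative grad f (x + t *\<^sub>R i) \<bullet> i) (at t within {-1..1})"
      by (simp add: has_field_derivative_def inner_commute mult_commute_abs)
  next
    show "continuous_on ({-1..1} \<times> cbox (- a) a) (\<lambda>(t, x). grad f (x + t *\<^sub>R i) \<bullet> i)"
      unfolding split_beta by (intro continuous_on_compose2[OF cg] continuous_intros) auto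
  next
    fix t
    show "(\<lambda>x. f (x + t *\<^sub>R i)) integrable_on cbox (- a) a"
      by (intro integrable_continuous continuous_on_compose2[OF cf] continuous_intros) auto
  qed auto
  moreover have "(?g has_field_derivative 0) (at 0 within {-1..1})"
    by (rule has_field_derivative_transform_within[OF DERIV_const, of 1 0 _ "LINT x|lborel. f x"])
       (auto simp: const)
  moreover have "at (0::real) within {-1..1} = at 0"
    by (simp add: at_within_Icc_at)
  ultimately have "integral (cbox (- a) a) (\<lambda>x. grad f (x + 0 *\<^sub>R i) \<bullet> i) = 0"
    by (metis DERIV_unique)
  then have "integral (cbox (- a) a) (\<lambda>x. grad f x \<bullet> i) = 0"
    by simp
  moreover have "integral (cbox (- a) a) (\<lambda>x. grad f x \<bullet> i) = integral UNIV (\<lambda>x. grad f x \<bullet> i)"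
  proof (rule integral_eq_integral_UNIV[symmetric])
    fix x assume "x \<notin> cbox (- a) a"
    then have "norm x > r" using a by (force simp: subset_eq not_le)
    then show "grad f x \<bullet> i = 0" using grad_eq_0_outside_support[of r f x, OF supp] by simp
  qed
  moreover have "\<dots> = (LINT x|lborel. grad f x \<bullet> i)"
    by (rule integral_lborel, rule integrable_compact_support[of _ r])
      (auto intro!: continuous_intros cg simp: grad_eq_0_outside_support[OF supp])
  ultimately show ?thesis by (simp add: partial_eq_grad_inner[OF f])
qed

lemma integral_divergence_eq_0:
  fixes F :: "'a::euclidean_space \<Rightarrow> 'a \<Rightarrow> real"
  assumes F: "\<And>i. i \<in> Basis \<Longrightarrow> C1 (F i)"
    and supp: "\<And>i x. i \<in> Basis \<Longrightarrow> norm x > r \<Longrightarrow> F i x = 0"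
  shows "(LINT x|lborel. (\<Sum>i\<in>Basis. partial i (F i) x)) = 0"
proof -
  have "integrable lborel (partial i (F i))" if "i \<in> Basis" for i
  proof (rule integrable_compact_support)
    show "continuous_on UNIV (partial i (F i))" using F that by (auto simp: C1_def)
    show "partial i (F i) x = 0" if "norm x > r" for x
      using grad_eq_0_outside_support[of r "F i" x] supp that \<open>i \<in> Basis\<close>
      by (simp add: partial_eq_grad_inner F)
  qed
  then show ?thesis
    using integral_partial_eq_0[OF F supp] by simp
qed

section \<open>Scale-invariant cut-off functions in the plane\<close>

definition cutoff :: "real \<Rightarrow> 'a::euclidean_space \<Rightarrow> real" where
  "cutoff R x = max 0 (1 - (1 / R\<^sup>2) * (x \<bullet> x)) ^ 3"

lemma C2_cutoff: "C2 (cutoff R)"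
  unfolding cutoff_def[abs_def]
  by (intro C2_pos_part_cube C2_diff C2_mult C2_const C2_inner_self)

lemma cutoff_eq_0:
  assumes "R > 0" "norm x > R"
  shows "cutoff R x = 0"
proof -
  have "x \<bullet> x > R\<^sup>2"
    using assms by (simp add: dot_square_norm power_strict_mono)
  then show ?thesis using assms by (simp add: cutoff_def max_def field_simps)
qed

lemma cutoff_nonneg: "0 \<le> cutoff R x"
  and cutoff_le_1: "cutoff R x \<le> 1"
  by (auto simp: cutoff_def intro!: power_le_one)

lemma norm_grad_cutoff_le:
  assumes "R > 0"
  shows "norm (grad (cutoff R) x) \<le> 6 / R"
proof (cases "norm x > R")
  case True
  then show ?thesis
    using grad_eq_0_outside_support[of R "cutoff R" x, OF cutoff_eq_0[OF assms] True] assms by simp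
next
  case False
  let ?m = "max 0 (1 - (1 / R\<^sup>2) * (x \<bullet> x))"
  have "((\<lambda>s. max 0 (1 - (1 / R\<^sup>2) * s) ^ 3) has_real_derivative (3 * ?m\<^sup>2) * (- (1 / R\<^sup>2))) (at (x \<bullet> x))"
  proof (rule DERIV_chain2[of "\<lambda>y. max 0 y ^ 3"])
    show "((\<lambda>y. max 0 y ^ 3) has_real_derivative 3 * ?m\<^sup>2) (at (1 - (1 / R\<^sup>2) * (x \<bullet> x)))"
      using DERIV_pos_part_power[of 1 "1 - (1 / R\<^sup>2) * (x \<bullet> x)"] by (simp add: eval_nat_numeral)
    show "((\<lambda>s. 1 - (1 / R\<^sup>2) * s) has_real_derivative - (1 / R\<^sup>2)) (at (x \<bullet> x))"
      using DERIV_diff[OF DERIV_const DERIV_cmult[OF DERIV_ident, of "1 / R\<^sup>2"]] by simp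
  qed
  from grad_compose[OF C1_inner_self this]
  have "grad (cutoff R) x = ((3 * ?m\<^sup>2) * (- (1 / R\<^sup>2))) *\<^sub>R (2 *\<^sub>R x)"
    by (simp add: cutoff_def[abs_def] GDERIV_imp_grad[OF GDERIV_inner_self])
  then have "norm (grad (cutoff R) x) = 6 * ?m\<^sup>2 * norm x / R\<^sup>2"
    by (simp add: abs_mult)
  also have "\<dots> \<le> 6 * 1 * R / R\<^sup>2"
    using False assms by (intro divide_right_mono mult_mono) (auto intro!: power_le_one)
  finally show ?thesis using assms by (simp add: power2_eq_square)
qed

text \<open>The gradient has size \<open>1 / R\<close> on a ball of volume proportional to \<open>R\<^sup>2\<close>: the Dirichlet
  integral is scale invariant in dimension two, so the bound does not depend on \<open>R\<close>.\<close>

lemma integral_grad_cutoff_le: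
  assumes "DIM('a::euclidean_space) = 2" "R > 0"
  shows "(LINT x|lborel. (norm (grad (cutoff R) (x::'a)))\<^sup>2) \<le> 36 * unit_ball_vol 2"
proof -
  have "(LINT x|lborel. (norm (grad (cutoff R) (x::'a)))\<^sup>2)
      \<le> (LINT x|lborel. (36 / R\<^sup>2) * indicator (cball 0 R) (x::'a))"
  proof (rule integral_mono)
    show "integrable lborel (\<lambda>x. (norm (grad (cutoff R) (x::'a)))\<^sup>2)"
      by (rule integrable_compact_support[of _ R])
        (auto intro!: continuous_intros C1_imp_continuous_grad C2_imp_C1 C2_cutoff
          simp: grad_eq_0_outside_support[OF cutoff_eq_0] assms)
    show "integrable lborel (\<lambda>x. (36 / R\<^sup>2) * indicator (cball 0 R) (x::'a))"
      by (intro integrable_mult_right integrable_real_indicator emeasure_compact_finite) auto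
    fix x :: 'a
    show "(norm (grad (cutoff R) x))\<^sup>2 \<le> (36 / R\<^sup>2) * indicator (cball 0 R) x"
    proof (cases "norm x > R")
      case True
      then show ?thesis using grad_eq_0_outside_support[OF cutoff_eq_0[OF assms(2)]] by simp
    next
      case False
      have "(norm (grad (cutoff R) x))\<^sup>2 \<le> (6 / R)\<^sup>2"
        using norm_grad_cutoff_le[OF assms(2)] by (intro power_mono) auto
      then show ?thesis using False by (simp add: power_divide)
    qed
  qed
  also have "\<dots> = (36 / R\<^sup>2) * measure lborel (cball (0::'a) R)"
    by simp
  also have "\<dots> = 36 * unit_ball_vol 2"
    using assms by (simp add: content_cball)
  finally show ?thesis .
qed

section \<open>Integrability of the weight and of the squared gradient\<close>

text \<open>The stability inequality is tested with a function that vanishes on the inner ball and agrees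
  with the cut-off of radius \<open>R\<close> further out. Its Dirichlet integral is bounded independently of
  \<open>R\<close>, the outer part by scale invariance and the inner part because it is a fixed function;
  near the inner ball the weight is integrable by continuity.\<close>

lemma weighted_integral_bounded:
  fixes w :: "'a::euclidean_space \<Rightarrow> real"
  assumes dim: "DIM('a) = 2" and w: "continuous_on UNIV w" "\<And>x. w x \<ge> 0" and "c > 0"
    and stab: "\<And>\<phi>. \<phi> \<in> C2_compact \<Longrightarrow> (\<And>x. x \<bullet> x \<le> a \<Longrightarrow> \<phi> x = 0) \<Longrightarrow>
      c * (LINT x|lborel. w x * (\<phi> x)\<^sup>2) \<le> (LINT x|lborel. (norm (grad \<phi> x))\<^sup>2)"
  shows "\<exists>C. \<forall>R>0. (LINT x|lborel. w x * (cutoff R x)\<^sup>2) \<le> C"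
proof -
  \<comment> \<open>The factor \<open>1 - \<kappa>\<close> is the inner transition: 0 where \<open>x \<bullet> x \<le> a\<close> and 1 where
    \<open>x \<bullet> x \<ge> a + 1\<close>. Cubing twice keeps it twice continuously differentiable.\<close>
  define \<kappa> :: "'a \<Rightarrow> real" where "\<kappa> x = max 0 (1 - max 0 (x \<bullet> x - a) ^ 3) ^ 3" for x
  have C2\<kappa>: "C2 \<kappa>"
    unfolding \<kappa>_def[abs_def] by (intro C2_pos_part_cube C2_diff C2_const C2_inner_self)
  have \<kappa>01: "0 \<le> \<kappa> x" "\<kappa> x \<le> 1" for x by (auto simp: \<kappa>_def intro!: power_le_one)
  have \<kappa>1: "\<kappa> x = 1" if "x \<bullet> x \<le> a" for x using that by (simp add: \<kappa>_def)
  \<comment> \<open>For \<open>norm x \<ge> 1\<close> one has \<open>x \<bullet> x \<ge> norm x\<close>, so \<open>a + 1\<close> serves as a radius as well.\<close>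
  define r where "r = max 1 (a + 1)"
  have \<kappa>0: "\<kappa> x = 0" if "norm x > r" for x
  proof -
    have "norm x * 1 \<le> norm x * norm x" using that unfolding r_def by (intro mult_left_mono) auto
    then have "1 \<le> x \<bullet> x - a"
      using that unfolding r_def by (auto simp: dot_square_norm power2_eq_square)
    then have "1 \<le> max 0 (x \<bullet> x - a) ^ 3" by (intro one_le_power) auto
    then show ?thesis by (simp add: \<kappa>_def)
  qed
  note C1\<kappa> = C2_imp_C1[OF C2\<kappa>] and C1c = C2_imp_C1[OF C2_cutoff]
  note cont = C1_imp_continuous[OF C1\<kappa>] C1_imp_continuous_grad[OF C1\<kappa>]
    C1_imp_continuous[OF C1c] C1_imp_continuous_grad[OF C1c] w(1)
  have grad\<kappa>0: "grad \<kappa> x = 0" if "norm x > r" for x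
    using grad_eq_0_outside_support[of r \<kappa> x, OF \<kappa>0 that] .
  define K where "K = (LINT x|lborel. (norm (grad \<kappa> x))\<^sup>2)"
  define L where "L = (LINT x|lborel. w x * (1 - (1 - \<kappa> x)\<^sup>2))"
  have "(LINT x|lborel. w x * (cutoff R x)\<^sup>2) \<le> (72 * unit_ball_vol 2 + 2 * K) / c + L"
    if "R > 0" for R
  proof -
    let ?\<phi> = "\<lambda>x::'a. (1 - \<kappa> x) * cutoff R x"
    note cutoff0 = cutoff_eq_0[OF that]
    have gradc0: "grad (cutoff R) x = 0" if "norm x > R" for x :: 'a
      using grad_eq_0_outside_support[of R "cutoff R" x, OF cutoff0 that] .
    have C2\<phi>: "C2 ?\<phi>" by (intro C2_mult C2_diff C2_const C2\<kappa> C2_cutoff)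
    have "bounded {x. ?\<phi> x \<noteq> 0}"
      unfolding bounded_iff using cutoff0 by (metis (mono_tags, lifting) mem_Collect_eq mult_eq_0_iff not_le)
    then have "?\<phi> \<in> C2_compact"
      using C2\<phi> by (simp add: C2_compact_def)
    from stab[OF this] have stab\<phi>: "c * (LINT x|lborel. w x * (?\<phi> x)\<^sup>2) \<le> (LINT x|lborel. (norm (grad ?\<phi> x))\<^sup>2)"
      using \<kappa>1 by simp
    have grad\<phi>: "grad ?\<phi> x = (1 - \<kappa> x) *\<^sub>R grad (cutoff R) x - cutoff R x *\<^sub>R grad \<kappa> x" for x
    proof -
      have "GDERIV (\<lambda>x. 1 - \<kappa> x) x :> 0 - grad \<kappa> x"
        by (intro GDERIV_diff GDERIV_const C1_imp_GDERIV C1\<kappa>)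
      from GDERIV_imp_grad[OF this]
      show ?thesis by (subst grad_mult) (auto intro: C1_diff C1_const C1\<kappa> C1c)
    qed
    have int1: "integrable lborel (\<lambda>x::'a. (norm (grad (cutoff R) x))\<^sup>2)"
      by (rule integrable_compact_support[of _ R]) (auto intro!: continuous_intros cont simp: gradc0)
    have int2: "integrable lborel (\<lambda>x. (norm (grad \<kappa> x))\<^sup>2)"
      by (rule integrable_compact_support[of _ r]) (auto intro!: continuous_intros cont simp: grad\<kappa>0)
    have "(LINT x|lborel. (norm (grad ?\<phi> x))\<^sup>2) \<le>
        (LINT x::'a|lborel. 2 * (norm (grad (cutoff R) x))\<^sup>2 + 2 * (norm (grad \<kappa> x))\<^sup>2)"
    proof (rule integral_mono)
      show "integrable lborel (\<lambda>x. (norm (grad ?\<phi> x))\<^sup>2)"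
        unfolding grad\<phi>
        by (rule integrable_compact_support[of _ R])
          (auto intro!: continuous_intros cont simp: gradc0 cutoff0)
      show "integrable lborel (\<lambda>x::'a. 2 * (norm (grad (cutoff R) x))\<^sup>2 + 2 * (norm (grad \<kappa> x))\<^sup>2)"
        using int1 int2 by auto
      fix x
      have "norm (grad ?\<phi> x) \<le> norm (grad (cutoff R) x) + norm (grad \<kappa> x)"
      proof -
        have "norm (grad ?\<phi> x) \<le> norm ((1 - \<kappa> x) *\<^sub>R grad (cutoff R) x) + norm (cutoff R x *\<^sub>R grad \<kappa> x)"
          unfolding grad\<phi> by (rule norm_triangle_ineq4)
        also have "\<dots> = (1 - \<kappa> x) * norm (grad (cutoff R) x) + cutoff R x * norm (grad \<kappa> x)"
          using \<kappa>01[of x] cutoff_nonneg[of R x] by simp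
        also have "\<dots> \<le> 1 * norm (grad (cutoff R) x) + 1 * norm (grad \<kappa> x)"
          using \<kappa>01[of x] cutoff_le_1[of R x] by (intro add_mono mult_right_mono) auto
        finally show ?thesis by simp
      qed
      then have "(norm (grad ?\<phi> x))\<^sup>2 \<le> (norm (grad (cutoff R) x) + norm (grad \<kappa> x))\<^sup>2"
        by (intro power_mono) auto
      also have "\<dots> \<le> 2 * (norm (grad (cutoff R) x))\<^sup>2 + 2 * (norm (grad \<kappa> x))\<^sup>2"
        using sum_squares_bound[of "norm (grad (cutoff R) x)" "norm (grad \<kappa> x)"]
        by (simp add: power2_sum)
      finally show "(norm (grad ?\<phi> x))\<^sup>2 \<le> 2 * (norm (grad (cutoff R) x))\<^sup>2 + 2 * (norm (grad \<kappa> x))\<^sup>2" .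
    qed
    also have "\<dots> = 2 * (LINT x::'a|lborel. (norm (grad (cutoff R) x))\<^sup>2) + 2 * K"
      using int1 int2 by (simp add: K_def)
    also have "\<dots> \<le> 72 * unit_ball_vol 2 + 2 * K"
      using integral_grad_cutoff_le[OF dim that] by simp
    finally have "(LINT x|lborel. w x * (?\<phi> x)\<^sup>2) \<le> (72 * unit_ball_vol 2 + 2 * K) / c"
      using stab\<phi> \<open>c > 0\<close> by (simp add: pos_le_divide_eq mult.commute)
    moreover have "(LINT x|lborel. w x * (cutoff R x)\<^sup>2) \<le>
        (LINT x|lborel. w x * (?\<phi> x)\<^sup>2 + w x * (1 - (1 - \<kappa> x)\<^sup>2))"
    proof (rule integral_mono)
      show "integrable lborel (\<lambda>x. w x * (cutoff R x)\<^sup>2)"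
        by (rule integrable_compact_support[of _ R]) (auto intro!: continuous_intros cont simp: cutoff0)
      show "integrable lborel (\<lambda>x. w x * (?\<phi> x)\<^sup>2 + w x * (1 - (1 - \<kappa> x)\<^sup>2))"
        by (rule integrable_compact_support[of _ "max R r"])
          (auto intro!: continuous_intros cont simp: cutoff0 \<kappa>0)
      fix x
      have "0 \<le> 1 - (1 - \<kappa> x)\<^sup>2"
        using \<kappa>01[of x] by (simp add: power_le_one)
      then have "(1 - (1 - \<kappa> x)\<^sup>2) * (cutoff R x)\<^sup>2 \<le> (1 - (1 - \<kappa> x)\<^sup>2) * 1"
        using cutoff_le_1[of R x] cutoff_nonneg[of R x] by (intro mult_left_mono power_le_one)
      then have "(cutoff R x)\<^sup>2 \<le> (?\<phi> x)\<^sup>2 + (1 - (1 - \<kappa> x)\<^sup>2)"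
        unfolding power_mult_distrib by (simp add: left_diff_distrib)
      from mult_left_mono[OF this w(2)[of x]]
      show "w x * (cutoff R x)\<^sup>2 \<le> w x * (?\<phi> x)\<^sup>2 + w x * (1 - (1 - \<kappa> x)\<^sup>2)"
        by (simp add: algebra_simps)
    qed
    moreover have "\<dots> = (LINT x|lborel. w x * (?\<phi> x)\<^sup>2) + L"
      unfolding L_def
    proof (rule Bochner_Integration.integral_add)
      show "integrable lborel (\<lambda>x. w x * (?\<phi> x)\<^sup>2)"
        by (rule integrable_compact_support[of _ R]) (auto intro!: continuous_intros cont simp: cutoff0)
      show "integrable lborel (\<lambda>x. w x * (1 - (1 - \<kappa> x)\<^sup>2))"
        by (rule integrable_compact_support[of _ r]) (auto intro!: continuous_intros cont simp: \<kappa>0)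
    qed
    ultimately show ?thesis by linarith
  qed
  then show ?thesis by blast
qed

text \<open>Integrating the divergence of \<open>\<eta>\<^sup>2 grad v\<close> gives the Dirichlet integral of \<open>v\<close> in terms of
  that of the weight, up to a cross term. Half of the Dirichlet integral absorbs the cross term,
  which explains the factors 2 and 4.\<close>

lemma riccati_dirichlet_le:
  fixes v w \<eta> :: "'a::euclidean_space \<Rightarrow> real"
  assumes v: "C2 v" and w: "continuous_on UNIV w"
    and eq: "\<And>x. laplacian v x = w x - (norm (grad v x))\<^sup>2"
    and \<eta>: "C1 \<eta>" and supp: "\<And>x. norm x > r \<Longrightarrow> \<eta> x = 0"
  shows "(LINT x|lborel. (norm (grad v x))\<^sup>2 * (\<eta> x)\<^sup>2)
    \<le> 2 * (LINT x|lborel. w x * (\<eta> x)\<^sup>2) + 4 * (LINT x|lborel. (norm (grad \<eta> x))\<^sup>2)"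
proof -
  let ?F = "\<lambda>i x. (\<eta> x * \<eta> x) * partial i v x"
  note C1v = C2_imp_C1[OF v]
  note cont = C1_imp_continuous_grad[OF C1v] C1_imp_continuous[OF \<eta>] C1_imp_continuous_grad[OF \<eta>] w
  have grad0: "grad \<eta> x = 0" if "norm x > r" for x
    using grad_eq_0_outside_support[of r \<eta> x, OF supp that] .
  have C1F: "C1 (?F i)" if "i \<in> Basis" for i
    using that by (intro C1_mult \<eta> C2_imp_C1_partial v)
  have "(LINT x|lborel. (\<Sum>i\<in>Basis. partial i (?F i) x)) = 0"
    by (rule integral_divergence_eq_0[of _ r]) (use C1F supp in auto)
  moreover have "(\<Sum>i\<in>Basis. partial i (?F i) x) =
     w x * (\<eta> x)\<^sup>2 - (norm (grad v x))\<^sup>2 * (\<eta> x)\<^sup>2 + 2 * \<eta> x * (grad \<eta> x \<bullet> grad v x)" for x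
  proof -
    have "(\<Sum>i\<in>Basis. partial i (?F i) x) =
      (\<Sum>i\<in>Basis. (\<eta> x)\<^sup>2 * partial i (partial i v) x + 2 * \<eta> x * ((grad \<eta> x \<bullet> i) * (grad v x \<bullet> i)))"
    proof (rule sum.cong[OF refl])
      fix i :: 'a assume "i \<in> Basis"
      then have "partial i (?F i) x = \<eta> x * \<eta> x * partial i (partial i v) x
          + partial i v x * (\<eta> x * partial i \<eta> x + \<eta> x * partial i \<eta> x)"
        by (simp only: partial_mult C1_mult \<eta> C2_imp_C1_partial v)
      then show "partial i (?F i) x =
          (\<eta> x)\<^sup>2 * partial i (partial i v) x + 2 * \<eta> x * ((grad \<eta> x \<bullet> i) * (grad v x \<bullet> i))"
        unfolding partial_eq_grad_inner[OF C1v, of i x] partial_eq_grad_inner[OF \<eta>, of i x]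
        by (rule trans) algebra
    qed
    also have "\<dots> = (\<eta> x)\<^sup>2 * laplacian v x + 2 * \<eta> x * (grad \<eta> x \<bullet> grad v x)"
      unfolding laplacian_def euclidean_inner[of "grad \<eta> x" "grad v x"]
      by (simp only: sum.distrib sum_distrib_left)
    finally show ?thesis by (simp add: eq algebra_simps)
  qed
  ultimately have "0 = (LINT x|lborel. w x * (\<eta> x)\<^sup>2 - (norm (grad v x))\<^sup>2 * (\<eta> x)\<^sup>2
      + 2 * \<eta> x * (grad \<eta> x \<bullet> grad v x))" by simp
  also have "\<dots> \<le> (LINT x|lborel. w x * (\<eta> x)\<^sup>2 - (1/2) * ((norm (grad v x))\<^sup>2 * (\<eta> x)\<^sup>2)
      + 2 * (norm (grad \<eta> x))\<^sup>2)"
  proof (rule integral_mono)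
    show "integrable lborel (\<lambda>x. w x * (\<eta> x)\<^sup>2 - (norm (grad v x))\<^sup>2 * (\<eta> x)\<^sup>2
        + 2 * \<eta> x * (grad \<eta> x \<bullet> grad v x))"
      by (rule integrable_compact_support[of _ r]) (auto intro!: continuous_intros cont simp: supp)
    show "integrable lborel (\<lambda>x. w x * (\<eta> x)\<^sup>2 - (1/2) * ((norm (grad v x))\<^sup>2 * (\<eta> x)\<^sup>2)
        + 2 * (norm (grad \<eta> x))\<^sup>2)"
      by (rule integrable_compact_support[of _ r]) (auto intro!: continuous_intros cont simp: supp grad0)
    fix x
    \<comment> \<open>Half of this is the absorbing inequality \<open>2ab \<le> a\<^sup>2/2 + 2b\<^sup>2\<close> for the cross term.\<close>
    have "0 \<le> (norm (\<eta> x *\<^sub>R grad v x - 2 *\<^sub>R grad \<eta> x))\<^sup>2" by simp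
    also have "\<dots> = (norm (grad v x))\<^sup>2 * (\<eta> x)\<^sup>2 - 4 * \<eta> x * (grad \<eta> x \<bullet> grad v x) + 4 * (norm (grad \<eta> x))\<^sup>2"
      unfolding power2_norm_eq_inner
      by (simp add: inner_diff_left inner_diff_right inner_commute power2_eq_square algebra_simps)
    finally show "w x * (\<eta> x)\<^sup>2 - (norm (grad v x))\<^sup>2 * (\<eta> x)\<^sup>2 + 2 * \<eta> x * (grad \<eta> x \<bullet> grad v x)
      \<le> w x * (\<eta> x)\<^sup>2 - (1/2) * ((norm (grad v x))\<^sup>2 * (\<eta> x)\<^sup>2) + 2 * (norm (grad \<eta> x))\<^sup>2"
      by simp
  qed
  also have "\<dots> = (LINT x|lborel. w x * (\<eta> x)\<^sup>2) - (1/2) * (LINT x|lborel. (norm (grad v x))\<^sup>2 * (\<eta> x)\<^sup>2)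
      + 2 * (LINT x|lborel. (norm (grad \<eta> x))\<^sup>2)"
  proof -
    have "integrable lborel (\<lambda>x. w x * (\<eta> x)\<^sup>2)" "integrable lborel (\<lambda>x. (norm (grad v x))\<^sup>2 * (\<eta> x)\<^sup>2)"
        "integrable lborel (\<lambda>x. (norm (grad \<eta> x))\<^sup>2)"
      by (rule integrable_compact_support[of _ r]; auto intro!: continuous_intros cont simp: supp grad0)+
    then show ?thesis by simp
  qed
  finally show ?thesis by simp
qed

text \<open>Means are taken over squares rather than balls: a square is a box, so its integrals can be
  differentiated with respect to a parameter and rescaled directly.\<close>

abbreviation square :: "real \<Rightarrow> 'a::euclidean_space set" where
  "square R \<equiv> cbox (- (R *\<^sub>R One)) (R *\<^sub>R One)"

lemma norm_le_in_square:
  assumes "x \<in> square R" "R \<ge> 0"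
  shows "(norm (x :: 'a::euclidean_space))\<^sup>2 \<le> real DIM('a) * R\<^sup>2"
proof -
  have "(norm x)\<^sup>2 = (\<Sum>i\<in>Basis. (x \<bullet> i)\<^sup>2)"
    unfolding power2_norm_eq_inner euclidean_inner[of x x] by (simp add: power2_eq_square)
  also have "\<dots> \<le> (\<Sum>i\<in>(Basis :: 'a set). R\<^sup>2)"
  proof (rule sum_mono)
    fix i :: 'a assume "i \<in> Basis"
    then have "\<bar>x \<bullet> i\<bar> \<le> R" using assms by (force simp: mem_box)
    then show "(x \<bullet> i)\<^sup>2 \<le> R\<^sup>2" using abs_le_square_iff[of "x \<bullet> i" R] assms by simp
  qed
  finally show ?thesis by simp
qed

text \<open>The square with half side \<open>R\<close> lies in the ball of radius \<open>sqrt 2 * R\<close>, where the cut-off of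
  radius \<open>2 * R\<close> is at least \<open>1/8\<close>.\<close>

lemma integral_square_le_cutoff:
  fixes f :: "'a::euclidean_space \<Rightarrow> real"
  assumes dim: "DIM('a) = 2" and f: "continuous_on UNIV f" "\<And>x. f x \<ge> 0" and "R > 0"
  shows "integral (square R) f
    \<le> 64 * (LINT x|lborel. f x * (cutoff (2 * R) x)\<^sup>2)"
proof -
  let ?B = "square R :: 'a set"
  have cont: "continuous_on UNIV (\<lambda>x. f x * (cutoff (2 * R) x)\<^sup>2)"
    by (intro continuous_intros f C1_imp_continuous C2_imp_C1 C2_cutoff)
  have int: "integrable lborel (\<lambda>x. f x * (cutoff (2 * R) x)\<^sup>2)"
    by (rule integrable_compact_support[OF cont, of "2 * R"]) (use \<open>R > 0\<close> in \<open>auto simp: cutoff_eq_0\<close>)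
  have "integral ?B f \<le> integral ?B (\<lambda>x. 64 * (f x * (cutoff (2 * R) x)\<^sup>2))"
  proof (rule integral_le)
    show "f integrable_on ?B"
      by (intro integrable_continuous continuous_on_subset[OF f(1)]) auto
    show "(\<lambda>x. 64 * (f x * (cutoff (2 * R) x)\<^sup>2)) integrable_on ?B"
      by (intro integrable_continuous continuous_intros continuous_on_subset[OF cont]) auto
    fix x assume x: "x \<in> ?B"
    have "x \<bullet> x \<le> 2 * R\<^sup>2"
      using norm_le_in_square[OF x] \<open>R > 0\<close> by (simp add: dim power2_norm_eq_inner)
    then have "1/2 \<le> 1 - (1 / (2 * R)\<^sup>2) * (x \<bullet> x)"
      using \<open>R > 0\<close> by (simp add: field_simps)
    then have "(1/2)^3 \<le> cutoff (2 * R) x"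
      unfolding cutoff_def by (intro power_mono) auto
    then have "((1/2)^3)\<^sup>2 \<le> (cutoff (2 * R) x)\<^sup>2"
      by (intro power_mono) auto
    then have "1 \<le> 64 * (cutoff (2 * R) x)\<^sup>2" by (simp add: power_divide)
    from mult_left_mono[OF this f(2)[of x]]
    show "f x \<le> 64 * (f x * (cutoff (2 * R) x)\<^sup>2)" by simp
  qed
  also have "\<dots> = 64 * integral ?B (\<lambda>x. f x * (cutoff (2 * R) x)\<^sup>2)" by simp
  also have "integral ?B (\<lambda>x. f x * (cutoff (2 * R) x)\<^sup>2) \<le> integral UNIV (\<lambda>x. f x * (cutoff (2 * R) x)\<^sup>2)"
  proof (rule integral_subset_le)
    show "(\<lambda>x. f x * (cutoff (2 * R) x)\<^sup>2) integrable_on ?B"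
      by (intro integrable_continuous continuous_on_subset[OF cont]) auto
    show "(\<lambda>x. f x * (cutoff (2 * R) x)\<^sup>2) integrable_on UNIV"
      using has_integral_integral_lborel[OF int] by blast
  qed (use f in auto)
  also have "\<dots> = (LINT x|lborel. f x * (cutoff (2 * R) x)\<^sup>2)"
    by (rule integral_lborel[OF int])
  finally show ?thesis by simp
qed

section \<open>Growth of means over squares\<close>

lemma integral_square_rescale:
  fixes f :: "'a::euclidean_space \<Rightarrow> real"
  assumes "continuous_on UNIV f" "R > 0"
  shows "integral (square 1) (\<lambda>y. f (R *\<^sub>R y)) = integral (square R) f / R ^ DIM('a)"
proof -
  have "(f has_integral integral (square R) f) (square R)"
    by (intro integrable_integral integrable_continuous continuous_on_subset[OF assms(1)]) auto
  from has_integral_affinity'[OF this assms(2), of 0]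
  show ?thesis using assms(2) by (auto simp: divide_inverse mult.commute dest!: integral_unique)
qed

lemma square_mono: "R \<le> S \<Longrightarrow> square R \<subseteq> (square S :: 'a::euclidean_space set)"
  by (auto simp: subset_box)

lemma measure_square_1: "measure lborel (square 1 :: 'a::euclidean_space set) = 2 ^ DIM('a)"
proof -
  have "measure lborel (square 1 :: 'a set) = (\<Prod>i\<in>(Basis :: 'a set). (One + One) \<bullet> i)"
    by (subst measure_lborel_cbox_eq) auto
  also have "\<dots> = (\<Prod>i\<in>(Basis :: 'a set). 2)"
    by (rule prod.cong) (auto simp: inner_add_left)
  finally show ?thesis by simp
qed

text \<open>As \<open>f\<close> has a finite integral, almost all of it lives on a fixed square, where \<open>norm x / R\<close>
  tends to 0; on the rest \<open>norm x / R\<close> is bounded and the integral of \<open>f\<close> is small.\<close>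

lemma weighted_square_integral_tendsto_0:
  fixes f :: "'a::euclidean_space \<Rightarrow> real"
  assumes f: "continuous_on UNIV f" "\<And>x. f x \<ge> 0"
    and bound: "\<And>R. R > 0 \<Longrightarrow> integral (square R) f \<le> B" and "\<epsilon> > 0"
  shows "\<forall>\<^sub>F R in at_top. integral (square R) (\<lambda>x. f x * (norm x)\<^sup>2) / R\<^sup>2 \<le> \<epsilon>"
proof -
  let ?n = "real DIM('a)"
  have n: "?n > 0" by simp
  have int: "f integrable_on square R" for R
    by (intro integrable_continuous continuous_on_subset[OF f(1)]) auto
  define I where "I R = integral (square R) f" for R
  let ?S = "I ` {0<..}"
  have bdd: "bdd_above ?S" using bound by (auto simp: I_def bdd_above_def)
  have "Sup ?S - \<epsilon> / (2 * ?n) < Sup ?S" using \<open>\<epsilon> > 0\<close> n by simp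
  then obtain r where r: "r > 0" "I r > Sup ?S - \<epsilon> / (2 * ?n)"
    using less_cSupD[of ?S] by (metis (no_types, lifting) greaterThan_iff imageE image_is_empty greaterThan_non_empty)
  have tail: "I R - I r \<le> \<epsilon> / (2 * ?n)" if "R \<ge> r" for R
    using cSup_upper[OF _ bdd, of "I R"] r that by fastforce
  have "((\<lambda>R. ?n * r\<^sup>2 * I r / R\<^sup>2) \<longlongrightarrow> 0) at_top"
    by real_asymp
  then have "\<forall>\<^sub>F R in at_top. ?n * r\<^sup>2 * I r / R\<^sup>2 < \<epsilon> / 2"
    by (rule order_tendstoD) (use \<open>\<epsilon> > 0\<close> in simp)
  then show ?thesis
    using eventually_ge_at_top[of r]
  proof eventually_elim
    case (elim R)
    have "R > 0" using elim r by linarith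
    have sub: "square r \<inter> square R = (square r :: 'a set)"
      using square_mono[OF elim(2)] by blast
    have intr: "(\<lambda>x. if x \<in> square r then f x else 0) integrable_on square R"
      using int[of r] unfolding integrable_restrict_Int sub .
    have "integral (square R) (\<lambda>x. f x * (norm x)\<^sup>2) \<le>
      integral (square R) (\<lambda>x. ?n * R\<^sup>2 * f x - ?n * (R\<^sup>2 - r\<^sup>2) * (if x \<in> square r then f x else 0))"
    proof (rule integral_le)
      show "(\<lambda>x. f x * (norm x)\<^sup>2) integrable_on square R"
        by (intro integrable_continuous continuous_intros continuous_on_subset[OF f(1)]) auto
      show "(\<lambda>x. ?n * R\<^sup>2 * f x - ?n * (R\<^sup>2 - r\<^sup>2) * (if x \<in> square r then f x else 0)) integrable_on square R"
        by (intro integrable_diff integrable_on_mult_right int intr)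
      fix x :: 'a assume x: "x \<in> square R"
      show "f x * (norm x)\<^sup>2 \<le> ?n * R\<^sup>2 * f x - ?n * (R\<^sup>2 - r\<^sup>2) * (if x \<in> square r then f x else 0)"
      proof (cases "x \<in> square r")
        case True
        then show ?thesis
          using mult_left_mono[OF norm_le_in_square[OF True] f(2)[of x]] r by (simp add: algebra_simps)
      next
        case False
        then show ?thesis
          using mult_left_mono[OF norm_le_in_square[OF x] f(2)[of x]] \<open>R > 0\<close> by (simp add: algebra_simps)
      qed
    qed
    also have "\<dots> = ?n * R\<^sup>2 * I R - ?n * (R\<^sup>2 - r\<^sup>2) * integral (square R) (\<lambda>x. if x \<in> square r then f x else 0)"
      unfolding I_def by (subst integral_diff) (auto intro!: integrable_on_mult_right int intr)
    also have "integral (square R) (\<lambda>x. if x \<in> square r then f x else 0) = I r"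
      unfolding integral_restrict_Int sub I_def ..
    finally have "integral (square R) (\<lambda>x. f x * (norm x)\<^sup>2) \<le> R\<^sup>2 * (?n * (I R - I r)) + ?n * r\<^sup>2 * I r"
      by (simp add: algebra_simps)
    also have "R\<^sup>2 * (?n * (I R - I r)) \<le> R\<^sup>2 * (\<epsilon> / 2)"
      using mult_left_mono[OF tail[OF elim(2)], of ?n] n by (intro mult_left_mono) auto
    finally have "integral (square R) (\<lambda>x. f x * (norm x)\<^sup>2) / R\<^sup>2 \<le> \<epsilon> / 2 + ?n * r\<^sup>2 * I r / R\<^sup>2"
      using \<open>R > 0\<close> by (simp add: field_simps)
    then show ?case using elim by linarith
  qed
qed

lemma DERIV_square_mean:
  fixes v :: "'a::euclidean_space \<Rightarrow> real"
  assumes v: "C1 v" and "R > 0"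
  shows "((\<lambda>R. integral (square 1) (\<lambda>y. v (R *\<^sub>R y))) has_real_derivative
    integral (square 1) (\<lambda>y. grad v (R *\<^sub>R y) \<bullet> y)) (at R)"
proof -
  have "((\<lambda>R. integral (square 1) (\<lambda>y. v (R *\<^sub>R y))) has_real_derivative
      integral (square 1) (\<lambda>y. grad v (R *\<^sub>R y) \<bullet> y)) (at R within UNIV)"
  proof (rule leibniz_rule_field_derivative)
    fix t :: real and y :: 'a
    have "((\<lambda>t. v (t *\<^sub>R y)) has_derivative (\<lambda>s. (s *\<^sub>R y) \<bullet> grad v (t *\<^sub>R y))) (at t within UNIV)"
      by (rule has_derivative_compose[where f = "\<lambda>t. t *\<^sub>R y"])
        (auto intro!: derivative_eq_intros C1_imp_GDERIV[OF v, unfolded gderiv_def])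
    then show "((\<lambda>t. v (t *\<^sub>R y)) has_field_derivative grad v (t *\<^sub>R y) \<bullet> y) (at t within UNIV)"
      by (simp add: has_field_derivative_def inner_commute mult_commute_abs)
  next
    show "continuous_on (UNIV \<times> square 1) (\<lambda>(t, y). grad v (t *\<^sub>R y) \<bullet> y)"
      unfolding split_beta
      by (intro continuous_intros continuous_on_compose2[OF C1_imp_continuous_grad[OF v]]) auto
  next
    fix t :: real
    show "(\<lambda>y. v (t *\<^sub>R y)) integrable_on square 1"
      by (intro integrable_continuous continuous_on_compose2[OF C1_imp_continuous[OF v]] continuous_intros) auto
  qed auto
  then show ?thesis by simp
qed

text \<open>Let \<open>m R\<close> be the integral of \<open>v\<close> over the square with half side \<open>R\<close>, rescaled to the
  square with half side 1, whose area is 4. If \<open>exp (- s * v)\<close> is integrable, its mean over the large square is of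
  order \<open>1 / R\<^sup>2\<close>; by convexity of the exponential the mean of \<open>s * v\<close> is then at least
  \<open>2 * ln R\<close> up to a constant, so that \<open>s * m R\<close> grows like \<open>8 * ln R\<close>. On the other hand
  \<open>R * m' R\<close> is controlled by the Dirichlet integral on scale \<open>R\<close>, weighted with
  \<open>(norm x / R)\<^sup>2\<close>, and tends to 0, so that \<open>m R\<close> grows slower than any multiple of \<open>ln R\<close>.\<close>

lemma no_finite_dirichlet_integral_with_integrable_exp:
  fixes v :: "'a::euclidean_space \<Rightarrow> real"
  assumes dim: "DIM('a) = 2" and v: "C1 v" and "s > 0"
    and dirichlet: "\<And>R. R > 0 \<Longrightarrow> integral (square R) (\<lambda>x. (norm (grad v x))\<^sup>2) \<le> B"
    and exponential: "\<And>R. R > 0 \<Longrightarrow> integral (square R) (\<lambda>x. exp (- s * v x)) \<le> A"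
  shows False
proof -
  note cv = C1_imp_continuous[OF v] and cg = C1_imp_continuous_grad[OF v]
  define m where "m R = integral (square 1) (\<lambda>y. v (R *\<^sub>R y))" for R
  have cscale: "continuous_on S (\<lambda>y. R *\<^sub>R y)" for S :: "'a set" and R :: real
    by (intro continuous_intros)
  have lower: "8 * ln R + 4 - A \<le> s * m R" if "R > 0" for R
  proof -
    \<comment> \<open>The tangent to the exponential takes the place of Jensen's inequality; the factor \<open>R\<^sup>2\<close>
      balances the area in the mean of \<open>exp (- s * v)\<close>.\<close>
    have "integral (square 1) (\<lambda>y. (1 + 2 * ln R) - s * v (R *\<^sub>R y))
        \<le> integral (square 1) (\<lambda>y. R\<^sup>2 * exp (- s * v (R *\<^sub>R y)))"
    proof (rule integral_le)
      show "(\<lambda>y. (1 + 2 * ln R) - s * v (R *\<^sub>R y)) integrable_on square 1"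
        by (intro integrable_continuous continuous_intros continuous_on_compose2[OF cv cscale]) auto
      show "(\<lambda>y. R\<^sup>2 * exp (- s * v (R *\<^sub>R y))) integrable_on square 1"
        by (intro integrable_continuous continuous_intros continuous_on_compose2[OF cv cscale]) auto
      fix y
      have "1 + (2 * ln R - s * v (R *\<^sub>R y)) \<le> exp (2 * ln R - s * v (R *\<^sub>R y))"
        by (rule exp_ge_add_one_self)
      also have "\<dots> = R\<^sup>2 * exp (- s * v (R *\<^sub>R y))"
        using that by (simp add: exp_diff exp_minus exp_double divide_inverse)
      finally show "(1 + 2 * ln R) - s * v (R *\<^sub>R y) \<le> R\<^sup>2 * exp (- s * v (R *\<^sub>R y))" by simp
    qed
    also have "\<dots> = R\<^sup>2 * (integral (square R) (\<lambda>x. exp (- s * v x)) / R ^ DIM('a))"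
      by (subst integral_square_rescale[symmetric, OF _ that])
        (auto intro!: continuous_intros cv)
    also have "\<dots> \<le> A"
      using exponential[OF that] that by (simp add: dim)
    finally have "integral (square 1) (\<lambda>y. (1 + 2 * ln R) - s * v (R *\<^sub>R y)) \<le> A" .
    moreover have "integral (square 1) (\<lambda>y. (1 + 2 * ln R) - s * v (R *\<^sub>R y)) = 4 * (1 + 2 * ln R) - s * m R"
    proof -
      have "(\<lambda>y. v (R *\<^sub>R y)) integrable_on square 1"
        by (intro integrable_continuous continuous_on_compose2[OF cv cscale]) auto
      then show ?thesis
        unfolding m_def using measure_square_1[where 'a='a]
        by (subst integral_diff) (auto intro!: integrable_on_mult_right simp: dim)
    qed
    ultimately show ?thesis by simp
  qed
  \<comment> \<open>The growth rate obtained below is \<open>5/2 * \<epsilon>\<close>; the choice makes \<open>s\<close> times it smaller than 8.\<close>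
  define \<epsilon> where "\<epsilon> = 1 / s"
  have "\<epsilon> > 0" using \<open>s > 0\<close> by (simp add: \<epsilon>_def)
  let ?k = "\<lambda>x. (norm (grad v x))\<^sup>2 * (norm x)\<^sup>2"
  have "\<forall>\<^sub>F R in at_top. integral (square R) ?k / R\<^sup>2 \<le> \<epsilon>\<^sup>2"
    by (rule weighted_square_integral_tendsto_0[OF _ _ dirichlet])
      (use \<open>\<epsilon> > 0\<close> in \<open>auto intro!: continuous_intros cg\<close>)
  then have "\<forall>\<^sub>F R in at_top. 1 \<le> R \<and> integral (square R) ?k / R\<^sup>2 \<le> \<epsilon>\<^sup>2"
    using eventually_ge_at_top[of 1] by (rule eventually_conj[rotated])
  then obtain r where r: "\<And>R. R \<ge> r \<Longrightarrow> 1 \<le> R \<and> integral (square R) ?k / R\<^sup>2 \<le> \<epsilon>\<^sup>2"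
    unfolding eventually_at_top_linorder by blast
  have deriv: "integral (square 1) (\<lambda>y. grad v (R *\<^sub>R y) \<bullet> y) \<le> 5/2 * \<epsilon> / R" if "R \<ge> r" for R
  proof -
    have R: "R \<ge> 1" "integral (square R) ?k / R\<^sup>2 \<le> \<epsilon>\<^sup>2" using r[OF that] by auto
    have "integral (square 1) (\<lambda>y. R * (grad v (R *\<^sub>R y) \<bullet> y))
      \<le> integral (square 1) (\<lambda>y. 1 / (2 * \<epsilon>) * ?k (R *\<^sub>R y) + \<epsilon> / 2)"
    proof (rule integral_le)
      show "(\<lambda>y. R * (grad v (R *\<^sub>R y) \<bullet> y)) integrable_on square 1"
        by (intro integrable_continuous continuous_intros continuous_on_compose2[OF cg cscale]) auto
      show "(\<lambda>y. 1 / (2 * \<epsilon>) * ?k (R *\<^sub>R y) + \<epsilon> / 2) integrable_on square 1"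
        by (intro integrable_continuous continuous_intros continuous_on_compose2[OF cg cscale]) auto
      fix y
      let ?a = "norm (grad v (R *\<^sub>R y)) * norm (R *\<^sub>R y)"
      \<comment> \<open>Young's inequality with parameter \<open>\<epsilon>\<close>, which replaces Cauchy-Schwarz for the integrals.\<close>
      have "R * (grad v (R *\<^sub>R y) \<bullet> y) = grad v (R *\<^sub>R y) \<bullet> (R *\<^sub>R y)" by simp
      also have "\<dots> \<le> ?a" by (rule norm_cauchy_schwarz)
      also have "?a \<le> ?a\<^sup>2 / (2 * \<epsilon>) + \<epsilon> / 2"
        using sum_squares_bound[of ?a \<epsilon>] \<open>\<epsilon> > 0\<close> by (simp add: field_simps power2_eq_square)
      finally show "R * (grad v (R *\<^sub>R y) \<bullet> y) \<le> 1 / (2 * \<epsilon>) * ?k (R *\<^sub>R y) + \<epsilon> / 2"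
        by (simp add: power_mult_distrib)
    qed
    also have "\<dots> = 1 / (2 * \<epsilon>) * (integral (square R) ?k / R\<^sup>2) + 2 * \<epsilon>"
    proof -
      have "(\<lambda>y. 1 / (2 * \<epsilon>) * ?k (R *\<^sub>R y)) integrable_on square 1"
        by (intro integrable_continuous continuous_intros continuous_on_compose2[OF cg cscale]) auto
      moreover have "(\<lambda>y::'a. \<epsilon> / 2) integrable_on square 1"
        by (intro integrable_continuous continuous_on_const)
      ultimately have "integral (square 1) (\<lambda>y. 1 / (2 * \<epsilon>) * ?k (R *\<^sub>R y) + \<epsilon> / 2)
          = integral (square 1) (\<lambda>y. 1 / (2 * \<epsilon>) * ?k (R *\<^sub>R y))
            + integral (square 1) (\<lambda>y::'a. \<epsilon> / 2)"
        by (rule integral_add)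
      moreover have "integral (square 1) (\<lambda>y. 1 / (2 * \<epsilon>) * ?k (R *\<^sub>R y))
          = 1 / (2 * \<epsilon>) * integral (square 1) (\<lambda>y. ?k (R *\<^sub>R y))"
        by (rule integral_mult_right)
      moreover have "integral (square 1) (\<lambda>y. ?k (R *\<^sub>R y)) = integral (square R) ?k / R ^ DIM('a)"
        by (rule integral_square_rescale) (use R(1) in \<open>auto intro!: continuous_intros cg\<close>)
      moreover have "integral (square 1) (\<lambda>y::'a. \<epsilon> / 2) = 2 * \<epsilon>"
        using measure_square_1[where 'a='a] by (simp only: integral_const dim) simp
      ultimately show ?thesis by (simp only: dim)
    qed
    also have "\<dots> \<le> 1 / (2 * \<epsilon>) * \<epsilon>\<^sup>2 + 2 * \<epsilon>"
      using R(2) \<open>\<epsilon> > 0\<close> by (intro add_mono mult_left_mono) auto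
    also have "\<dots> = 5/2 * \<epsilon>" using \<open>\<epsilon> > 0\<close> by (simp add: power2_eq_square)
    finally show ?thesis using R(1) by (simp add: field_simps)
  qed
  have upper: "m R - 5/2 * \<epsilon> * ln R \<le> m r - 5/2 * \<epsilon> * ln r" if "R \<ge> r" for R
  proof (rule DERIV_nonpos_imp_nonincreasing[OF that])
    fix t assume t: "r \<le> t"
    then have "t > 0" using r[of t] by auto
    have "((\<lambda>R. m R - 5/2 * \<epsilon> * ln R) has_real_derivative
        integral (square 1) (\<lambda>y. grad v (t *\<^sub>R y) \<bullet> y) - 5/2 * \<epsilon> * (1 / t)) (at t)"
      unfolding m_def using \<open>t > 0\<close>
      by (intro DERIV_diff DERIV_square_mean[OF v] DERIV_cmult DERIV_ln_divide)
    moreover have "integral (square 1) (\<lambda>y. grad v (t *\<^sub>R y) \<bullet> y) - 5/2 * \<epsilon> * (1 / t) \<le> 0"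
      using deriv[OF t] by simp
    ultimately show "\<exists>D. ((\<lambda>R. m R - 5/2 * \<epsilon> * ln R) has_real_derivative D) (at t) \<and> D \<le> 0" by blast
  qed
  define C where "C = s * (m r - 5/2 * \<epsilon> * ln r) + A - 4"
  have bound: "11/2 * ln R \<le> C" if "R \<ge> r" for R
  proof -
    have "R > 0" using r[OF that] by auto
    have "s * (m R - 5/2 * \<epsilon> * ln R) \<le> s * (m r - 5/2 * \<epsilon> * ln r)"
      using upper[OF that] \<open>s > 0\<close> by (intro mult_left_mono) auto
    moreover have "s * (m R - 5/2 * \<epsilon> * ln R) = s * m R - 5/2 * ln R"
      using \<open>s > 0\<close> by (simp add: \<epsilon>_def right_diff_distrib)
    ultimately show ?thesis using lower[OF \<open>R > 0\<close>] unfolding C_def by linarith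
  qed
  have "ln (exp (\<bar>C\<bar> + 1)) \<le> ln (max r (exp (\<bar>C\<bar> + 1)))"
    by (subst ln_le_cancel_iff) (auto simp: less_max_iff_disj)
  then show False using bound[of "max r (exp (\<bar>C\<bar> + 1))"] by auto
qed

section \<open>Solutions of finite Morse index\<close>

text \<open>Finitely many compactly supported functions live in a common ball, and every function that
  vanishes on this ball is orthogonal to their span, since the products vanish pointwise.\<close>

lemma finite_morse_index_imp_stable_outside_ball:
  assumes "finite_morse_index \<tau> u"
  shows "\<exists>a. \<forall>\<psi>\<in>C2_compact. (\<forall>x. x \<bullet> x \<le> a \<longrightarrow> \<psi> x = 0) \<longrightarrow> 0 \<le> energy \<tau> u \<psi>"
proof -
  obtain k where "has_morse_index \<tau> u k"
    using assms unfolding finite_morse_index_def by blast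
  then obtain \<phi> where \<phi>: "\<forall>j\<in>{1..k}. \<phi> j \<in> C2_compact \<and> \<phi> j \<noteq> (\<lambda>x. 0)"
    and stable: "\<forall>\<psi>\<in>C2_compact. (\<forall>w\<in>lin_span k \<phi> - {\<lambda>x. 0}. L2_orthogonal \<psi> w) \<longrightarrow>
      energy \<tau> u \<psi> \<ge> 0"
    unfolding has_morse_index_def Let_def by (elim exE conjE) (rule that)
  have "bounded (\<Union>j\<in>{1..k}. {x. \<phi> j x \<noteq> 0})"
  proof (rule bounded_UN)
    show "\<forall>j\<in>{1..k}. bounded {x. \<phi> j x \<noteq> 0}"
    proof
      fix j assume "j \<in> {1..k}"
      then have "compact (closure {x. \<phi> j x \<noteq> 0})"
        using \<phi> unfolding C2_compact_def by blast
      then show "bounded {x. \<phi> j x \<noteq> 0}"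
        using bounded_subset[OF compact_imp_bounded closure_subset] by blast
    qed
  qed simp
  then obtain b where "\<forall>x\<in>(\<Union>j\<in>{1..k}. {x. \<phi> j x \<noteq> 0}). norm x \<le> b"
    unfolding bounded_iff by blast
  then have b: "norm x \<le> b" if "j \<in> {1..k}" "\<phi> j x \<noteq> 0" for j x
    using that by blast
  have "0 \<le> energy \<tau> u \<psi>" if \<psi>: "\<psi> \<in> C2_compact" "\<And>x. x \<bullet> x \<le> b\<^sup>2 \<Longrightarrow> \<psi> x = 0" for \<psi>
  proof (rule stable[rule_format, OF \<psi>(1)])
    fix w assume "w \<in> lin_span k \<phi> - {\<lambda>x. 0}"
    then obtain c where w: "w = (\<lambda>x. \<Sum>j=1..k. c j * \<phi> j x)"
      unfolding lin_span_def by blast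
    have "\<psi> x * w x = 0" for x
    proof (cases "x \<bullet> x \<le> b\<^sup>2")
      case True
      then show ?thesis using \<psi>(2) by simp
    next
      case False
      have "\<phi> j x = 0" if "j \<in> {1..k}" for j
        using b[OF that, of x] False power_mono[of "norm x" b 2] by (auto simp: power2_norm_eq_inner)
      then show ?thesis unfolding w by simp
    qed
    then have "(\<lambda>x. \<psi> x * w x) = (\<lambda>x. 0)" by blast
    then show "L2_orthogonal \<psi> w" unfolding L2_orthogonal_def by (simp only: integral_zero)
  qed
  then show ?thesis by blast
qed

lemma C1_one_over:
  assumes "C1 u" "\<And>x. u x > 0"
  shows "C1 (\<lambda>x. 1 / u x)"
    and "partial i (\<lambda>x. 1 / u x) x = - (1 / (u x)\<^sup>2) * partial i u x"
proof -
  have dinv: "((\<lambda>y. 1 / y) has_real_derivative - (1 / (u x)\<^sup>2)) (at (u x))" for x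
    using assms(2)[of x] by (auto intro!: derivative_eq_intros simp: power2_eq_square)
  have "y \<noteq> 0" if "y \<in> range u" for y using that assms(2) by (metis imageE less_irrefl)
  then have "continuous_on (range u) (\<lambda>y. - (1 / y\<^sup>2))"
    by (intro continuous_intros) auto
  then show "C1 (\<lambda>x. 1 / u x)"
    by (rule C1_compose[OF assms(1) dinv])
  show "partial i (\<lambda>x. 1 / u x) x = - (1 / (u x)\<^sup>2) * partial i u x"
    by (rule partial_compose[OF assms(1) dinv])
qed

lemma partial_ln:
  assumes "C1 u" "\<And>x. u x > 0"
  shows "partial i (\<lambda>x. ln (u x)) = (\<lambda>x. 1 / u x * partial i u x)"
  using partial_compose[OF assms(1) DERIV_ln_divide[OF assms(2)]] by blast

lemma C2_ln:
  assumes "C2 u" "\<And>x. u x > 0"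
  shows "C2 (\<lambda>x. ln (u x))"
proof -
  note C1u = C2_imp_C1[OF assms(1)]
  have "y \<noteq> 0" if "y \<in> range u" for y using that assms(2) by (metis imageE less_irrefl)
  then have "continuous_on (range u) (\<lambda>y. 1 / y)"
    by (intro continuous_intros) auto
  then have "C1 (\<lambda>x. ln (u x))"
    by (rule C1_compose[OF C1u DERIV_ln_divide[OF assms(2)]])
  then show ?thesis
    unfolding C2_def partial_ln[OF C1u assms(2)]
    by (intro conjI ballI C1_mult C1_one_over(1) C2_imp_C1_partial C1u assms)
qed

text \<open>The logarithm turns \<open>laplacian u = u powr \<tau>\<close> into a Riccati type equation whose inhomogeneity
  is the weight of the energy, as \<open>u powr \<tau> / u = u powr (\<tau> - 1)\<close>.\<close>

lemma laplacian_ln: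
  assumes u: "C2 u" "\<And>x. u x > 0"
  shows "laplacian (\<lambda>x. ln (u x)) x = laplacian u x / u x - (norm (grad (\<lambda>x. ln (u x)) x))\<^sup>2"
proof -
  note C1u = C2_imp_C1[OF u(1)]
  have "partial i (partial i (\<lambda>x. ln (u x))) x =
      partial i (partial i u) x / u x - (partial i u x / u x)\<^sup>2" if i: "i \<in> Basis" for i
    unfolding partial_ln[OF C1u u(2)]
      partial_mult[OF C1_one_over(1)[OF C1u u(2)] C2_imp_C1_partial[OF u(1) i]]
      C1_one_over(2)[OF C1u u(2)]
    by (simp add: power2_eq_square)
  then have "laplacian (\<lambda>x. ln (u x)) x = laplacian u x / u x - (\<Sum>i\<in>Basis. (partial i u x / u x)\<^sup>2)"
    unfolding laplacian_def by (simp add: sum_subtractf sum_divide_distrib)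
  also have "(\<Sum>i\<in>Basis. (partial i u x / u x)\<^sup>2) = (norm (grad (\<lambda>x. ln (u x)) x))\<^sup>2"
    unfolding grad_compose[OF C1u DERIV_ln_divide[OF u(2)]] power2_norm_eq_inner
      euclidean_inner[of "(1 / u x) *\<^sub>R grad u x" "(1 / u x) *\<^sub>R grad u x"]
    by (simp add: partial_eq_grad_inner[OF C1u] power2_eq_square)
  finally show ?thesis .
qed

theorem theorem8:
  fixes \<tau> :: real
  assumes "\<tau> < 0"
  shows "\<not> (\<exists>u :: real ^ 2 \<Rightarrow> real. positive_solution \<tau> u \<and> finite_morse_index \<tau> u)"
proof
  assume "\<exists>u :: real ^ 2 \<Rightarrow> real. positive_solution \<tau> u \<and> finite_morse_index \<tau> u"
  then obtain u :: "real ^ 2 \<Rightarrow> real"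
    where u: "C2 u" "\<And>x. u x > 0" "\<And>x. laplacian u x = u x powr \<tau>"
      and fin: "finite_morse_index \<tau> u"
    unfolding positive_solution_def by blast
  have dim: "DIM(real ^ 2) = 2" by simp
  define v where "v x = ln (u x)" for x
  define w where "w x = u x powr (\<tau> - 1)" for x
  have C2v: "C2 v" unfolding v_def[abs_def] by (rule C2_ln[OF u(1,2)])
  note C1v = C2_imp_C1[OF C2v]
  have w_exp: "w x = exp (- (1 - \<tau>) * v x)" for x
    using u(2)[of x] by (simp add: w_def v_def powr_def)
  have contw: "continuous_on UNIV w"
    unfolding w_exp[abs_def] by (intro continuous_intros C1_imp_continuous C1v)
  have w0: "w x \<ge> 0" for x by (simp add: w_def)
  have riccati: "laplacian v x = w x - (norm (grad v x))\<^sup>2" for x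
  proof -
    have "u x powr \<tau> / u x = w x" using u(2)[of x] by (simp add: w_def powr_diff)
    then show ?thesis unfolding v_def[abs_def] by (simp add: laplacian_ln u)
  qed
  obtain a where a: "\<And>\<phi>. \<phi> \<in> C2_compact \<Longrightarrow> (\<And>x. x \<bullet> x \<le> a \<Longrightarrow> \<phi> x = 0) \<Longrightarrow> 0 \<le> energy \<tau> u \<phi>"
    using finite_morse_index_imp_stable_outside_ball[OF fin] by blast
  have stab: "- \<tau> * (LINT x|lborel. w x * (\<phi> x)\<^sup>2) \<le> (LINT x|lborel. (norm (grad \<phi> x))\<^sup>2)"
    if \<phi>: "\<phi> \<in> C2_compact" "\<And>x. x \<bullet> x \<le> a \<Longrightarrow> \<phi> x = 0" for \<phi>
  proof -
    have C1\<phi>: "C1 \<phi>" and "bounded {x. \<phi> x \<noteq> 0}"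
      using \<phi>(1) unfolding C2_compact_def
      by (auto intro: C2_imp_C1 bounded_subset[OF compact_imp_bounded closure_subset])
    then obtain r where r: "\<And>x. norm x > r \<Longrightarrow> \<phi> x = 0"
      unfolding bounded_iff by (metis (mono_tags) mem_Collect_eq not_le)
    have "integrable lborel (\<lambda>x. (norm (grad \<phi> x))\<^sup>2)"
      by (rule integrable_compact_support[of _ r])
        (auto intro!: continuous_intros C1_imp_continuous_grad C1\<phi> simp: grad_eq_0_outside_support[of r \<phi>, OF r])
    moreover have "integrable lborel (\<lambda>x. w x * (\<phi> x)\<^sup>2)"
      by (rule integrable_compact_support[of _ r])
        (auto intro!: continuous_intros C1_imp_continuous[OF C1\<phi>] contw simp: r)
    ultimately have "energy \<tau> u \<phi> = (LINT x|lborel. (norm (grad \<phi> x))\<^sup>2) + \<tau> * (LINT x|lborel. w x * (\<phi> x)\<^sup>2)"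
      unfolding energy_def w_def by (simp add: mult.assoc)
    then show ?thesis using a[OF \<phi>] by simp
  qed
  have "- \<tau> > 0" using assms by simp
  from weighted_integral_bounded[OF dim contw w0 this stab]
  obtain A where A: "\<And>R. R > 0 \<Longrightarrow> (LINT x|lborel. w x * (cutoff R x)\<^sup>2) \<le> A"
    by blast
  define B where "B = 2 * A + 4 * (36 * unit_ball_vol 2)"
  have B: "(LINT x|lborel. (norm (grad v x))\<^sup>2 * (cutoff R x)\<^sup>2) \<le> B" if "R > 0" for R
    using riccati_dirichlet_le[where r = R and \<eta> = "cutoff R", OF C2v contw riccati C2_imp_C1[OF C2_cutoff] cutoff_eq_0[OF that]]
      A[OF that] integral_grad_cutoff_le[OF dim that] unfolding B_def by linarith
  show False
  proof (rule no_finite_dirichlet_integral_with_integrable_exp[OF dim C1v,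
        where s = "1 - \<tau>" and A = "64 * A" and B = "64 * B"])
    fix R :: real assume "R > 0"
    have "continuous_on UNIV (\<lambda>x. (norm (grad v x))\<^sup>2)"
      by (intro continuous_intros C1_imp_continuous_grad C1v)
    from integral_square_le_cutoff[OF dim this _ \<open>R > 0\<close>]
    have "integral (square R) (\<lambda>x. (norm (grad v x))\<^sup>2)
        \<le> 64 * (LINT x|lborel. (norm (grad v x))\<^sup>2 * (cutoff (2 * R) x)\<^sup>2)"
      by simp
    then show "integral (square R) (\<lambda>x. (norm (grad v x))\<^sup>2) \<le> 64 * B"
      using B[of "2 * R"] \<open>R > 0\<close> by linarith
    have "integral (square R) w \<le> 64 * A"
      using integral_square_le_cutoff[OF dim contw w0 \<open>R > 0\<close>] A[of "2 * R"] \<open>R > 0\<close> by linarith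
    then show "integral (square R) (\<lambda>x. exp (- (1 - \<tau>) * v x)) \<le> 64 * A"
      by (simp only: w_exp[abs_def])
  qed (use assms in simp)
qed

end
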